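(* Let $k$ be a field of characteristic zero, let $A$ be an associative $k$-algebra with multiplication $ab$, and let $\lambda\in k$. Then the quasi-associative algebra $Q$, i.e. the vector space $A$ with the multiplication $a\circ b=\lambda ab+(1-\lambda)ba$, is conservative.
   Context: Algebras are vector spaces with a bilinear multiplication, not assumed unital. For a linear map $T$ and a bilinear map $B$ on a vector space put $[T,B](x,y)=T(B(x,y))-B(T(x),y)-B(x,T(y))$; this is again a bilinear map. An algebra with underlying vector space $V$, multiplication $P$ and left multiplications $L_a(x)=P(a,x)$ is called conservative if there exists a bilinear multiplication $F:V\times V\to V$ such that $[L_b,[L_a,P]]=-[L_{F(a,b)},P]$ for all $a,b\in V$. *)

theory Defs
  imports Complex_Main
begin

definition bilinear_map ::
  "('k::field \<Rightarrow> 'a::ab_group_add \<Rightarrow> 'a) \<Rightarrow> ('a \<Rightarrow> 'a \<Rightarrow> 'a) \<Rightarrow> bool" where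
  "bilinear_map scale B \<longleftrightarrow>
     (\<forall>x. Vector_Spaces.linear scale scale (\<lambda>y. B x y)) \<and>
     (\<forall>y. Vector_Spaces.linear scale scale (\<lambda>x. B x y))"

text \<open>Algebras are neither associative nor unital in general; the underlying vector space
  is the whole type, with scalar multiplication \<open>scale\<close>.\<close>

locale algebra_over = vector_space scale
  for scale :: "'k::field \<Rightarrow> 'a::ab_group_add \<Rightarrow> 'a" +
  fixes mult :: "'a \<Rightarrow> 'a \<Rightarrow> 'a"
  assumes bilinear_mult: "bilinear_map scale mult"

locale assoc_algebra_over = algebra_over scale mult
  for scale :: "'k::field \<Rightarrow> 'a::ab_group_add \<Rightarrow> 'a" and mult :: "'a \<Rightarrow> 'a \<Rightarrow> 'a" +
  assumes mult_assoc: "mult (mult x y) z = mult x (mult y z)"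

definition left_mult :: "('a \<Rightarrow> 'a \<Rightarrow> 'a) \<Rightarrow> 'a \<Rightarrow> 'a \<Rightarrow> 'a" where
  "left_mult P a = (\<lambda>x. P a x)"

definition bracket ::
  "('a::ab_group_add \<Rightarrow> 'a) \<Rightarrow> ('a \<Rightarrow> 'a \<Rightarrow> 'a) \<Rightarrow> 'a \<Rightarrow> 'a \<Rightarrow> 'a" where
  "bracket T B = (\<lambda>x y. T (B x y) - B (T x) y - B x (T y))"

definition conservative ::
  "('k::field \<Rightarrow> 'a::ab_group_add \<Rightarrow> 'a) \<Rightarrow> ('a \<Rightarrow> 'a \<Rightarrow> 'a) \<Rightarrow> bool" where
  "conservative scale P \<longleftrightarrow>
     algebra_over scale P \<and>
     (\<exists>F. bilinear_map scale F \<and>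
        (\<forall>a b. bracket (left_mult P b) (bracket (left_mult P a) P) =
               (\<lambda>x y. - bracket (left_mult P (F a b)) P x y)))"

definition quasi_assoc_mult ::
  "('k::field \<Rightarrow> 'a::ab_group_add \<Rightarrow> 'a) \<Rightarrow> ('a \<Rightarrow> 'a \<Rightarrow> 'a) \<Rightarrow> 'k \<Rightarrow> 'a \<Rightarrow> 'a \<Rightarrow> 'a" where
  "quasi_assoc_mult scale mult l = (\<lambda>a b. scale l (mult a b) + scale (1 - l) (mult b a))"

end

theory Submission
  imports Defs
begin

text \<open>
  Write \<open>a \<circ> b = \<lambda>ab + (1 - \<lambda>)ba\<close>, and for an element \<open>c\<close> let \<open>P\<^sub>c\<close> be the
  multiplication \<open>\<lambda>xcy + (1 - \<lambda>)ycx\<close>, obtained from \<open>\<circ>\<close> by inserting \<open>c\<close> in the middle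
  of each product. By associativity, bracketing left
  multiplication by \<open>b\<close> with \<open>(x, y) \<mapsto> xcy\<close> cancels every term except the one in which
  \<open>b\<close> stands beside \<open>c\<close>, which is \<open>-x(cb)y\<close>; right multiplication by \<open>b\<close> likewise
  leaves \<open>-x(bc)y\<close>. Hence
  \<open>[L\<^sub>b, P\<^sub>c] = -P\<close> with middle element \<open>c \<circ> b\<close> (lemma \<open>bracket_mid_mult\<close>). The product
  \<open>\<circ>\<close> itself behaves like \<open>P\<^sub>1\<close>, and although \<open>A\<close> need not have a unit the same computation
  gives \<open>[L\<^sub>a, \<circ>] = -P\<^sub>a\<close> (lemma \<open>bracket_quasi_assoc_mult\<close>), since the coefficients
  \<open>\<lambda>\<close> and \<open>1 - \<lambda>\<close> add up to one. Therefore \<open>[L\<^sub>b, [L\<^sub>a, \<circ>]]\<close> is \<open>P\<close> with middle element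
  \<open>a \<circ> b\<close>, which is \<open>-[L\<^sub>c, \<circ>]\<close> for \<open>c = a \<circ> b\<close>: the multiplication \<open>\<circ>\<close> itself
  can serve as \<open>F\<close>.
\<close>

lemma bracket_uminus:
  assumes "\<And>x. T (- x) = - T x"
  shows "bracket T (\<lambda>x y. - B x y) = (\<lambda>x y. - bracket T B x y)"
  by (simp add: bracket_def assms fun_eq_iff)

context algebra_over
begin

lemma linear_mult_right: "Vector_Spaces.linear scale scale (mult x)"
  and linear_mult_left: "Vector_Spaces.linear scale scale (\<lambda>x. mult x y)"
  using bilinear_mult by (simp_all add: bilinear_map_def)

lemmas mult_bilinear_simps =
  linear_mult_left [THEN module_hom_linearI, THEN module_hom.add]
  linear_mult_right [THEN module_hom_linearI, THEN module_hom.add]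
  linear_mult_left [THEN module_hom_linearI, THEN module_hom.diff]
  linear_mult_right [THEN module_hom_linearI, THEN module_hom.diff]
  linear_mult_left [THEN module_hom_linearI, THEN module_hom.scale]
  linear_mult_right [THEN module_hom_linearI, THEN module_hom.scale]

lemma bilinear_quasi_assoc_mult: "bilinear_map scale (quasi_assoc_mult scale mult l)"
  by (auto simp: bilinear_map_def quasi_assoc_mult_def Vector_Spaces.linear_iff
      mult_bilinear_simps scale_right_distrib vector_space_axioms mult.commute)

end

context assoc_algebra_over
begin

definition mid_mult :: "'k \<Rightarrow> 'a \<Rightarrow> 'a \<Rightarrow> 'a \<Rightarrow> 'a" where
  "mid_mult l c x y = scale l (mult x (mult c y)) + scale (1 - l) (mult y (mult c x))"

lemmas quasi_assoc_simps =
  mid_mult_def quasi_assoc_mult_def left_mult_def bracket_def mult_assoc mult_bilinear_simps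
  scale_right_distrib scale_left_diff_distrib scale_right_diff_distrib

text \<open>
  Inserting \<open>c\<close> commutes with applying \<open>L\<^sub>b\<close>, except when \<open>b\<close> lands beside \<open>c\<close>: those
  are the terms in which an argument is multiplied by \<open>b\<close> on its inner side, and they are
  all that survives.
\<close>

lemma bracket_mid_mult:
  "bracket (left_mult (quasi_assoc_mult scale mult l) b) (mid_mult l c) =
    (\<lambda>x y. - mid_mult l (quasi_assoc_mult scale mult l c b) x y)"
  by (simp add: fun_eq_iff quasi_assoc_simps algebra_simps)

text \<open>
  This is what the previous lemma would say for \<open>c\<close> a unit, as \<open>1 \<circ> a = a\<close>; without a
  unit the same terms cancel.
\<close>

lemma bracket_quasi_assoc_mult:
  "bracket (left_mult (quasi_assoc_mult scale mult l) a) (quasi_assoc_mult scale mult l) =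
    (\<lambda>x y. - mid_mult l a x y)"
  by (simp add: fun_eq_iff quasi_assoc_simps algebra_simps)

end

theorem mainTheorem8:
  fixes scale :: "'k::field_char_0 \<Rightarrow> 'a::ab_group_add \<Rightarrow> 'a"
    and mult :: "'a \<Rightarrow> 'a \<Rightarrow> 'a"
    and l :: 'k
  assumes "assoc_algebra_over scale mult"
  shows "conservative scale (quasi_assoc_mult scale mult l)"
proof -
  interpret assoc_algebra_over scale mult by fact
  let ?Q = "quasi_assoc_mult scale mult l"
  interpret Q: algebra_over scale ?Q
    by unfold_locales (rule bilinear_quasi_assoc_mult)
  have neg: "left_mult ?Q b (- x) = - left_mult ?Q b x" for b x
    unfolding left_mult_def
    by (rule module_hom.neg [OF module_hom_linearI [OF Q.linear_mult_right]])
  have "bracket (left_mult ?Q b) (bracket (left_mult ?Q a) ?Q) =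
      (\<lambda>x y. - bracket (left_mult ?Q (?Q a b)) ?Q x y)" for a b
    by (simp add: bracket_quasi_assoc_mult bracket_uminus neg bracket_mid_mult)
  then show ?thesis
    unfolding conservative_def
    using Q.algebra_over_axioms bilinear_quasi_assoc_mult by blast
qed

end
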